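(* Let $M$ be a finite-above $E$-unitary inverse monoid. Suppose that for some $a,b\in\max M$ with $a\,\sigma\,b$ and for some $v\in M/\sigma$ there exists $c\in\max v$ such that $$c\cdot h(a,b;v)\cdot c^{-1}b\not\le a .$$ Then $M$ has no $F$-inverse cover via Abelian groups.
   Context: In an inverse monoid $M$: $E$ is the set of idempotents, $a\le b$ iff $a=eb$ for some $e\in E$ (natural partial order), $\sigma$ is the least group congruence, $M$ is $E$-unitary if every element above an idempotent is idempotent, and $M$ is finite-above if $\{n\in M:n\ge m\}$ is finite for every $m\in M$. $\max M$ is the set of maximal elements of $(M,\le)$. For a $\sigma$-class $v\in M/\sigma$, $\max v$ is the set of maximal elements of the $\sigma$-class $v$. For $a,b\in M$ with $a\,\sigma\,b$ and $v\in M/\sigma$ put $H(a,b;v)=\{d^{-1}ab^{-1}d: d\in\max v\}$, which is a set of idempotents of $M$. The set of all upper bounds of $H(a,b;v)$ is a finite subsemilattice of $E$ containing $1$, hence $H(a,b;v)$ has a least upper bound, denoted $h(a,b;v)$. An inverse monoid is $F$-inverse if each $\sigma$-class has a greatest element. An $F$-inverse cover of $M$ is an $F$-inverse monoid $F$ with a surjective idempotent-separating homomorphism $F\to M$; this homomorphism induces a surjective homomorphism $F/\sigma\to M/\sigma$ with kernel $N$, say, and $F$ is called an $F$-inverse cover of $M$ via a class $\mathbf D$ of groups if $N\in\mathbf D$. *)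

theory Defs
  imports "HOL-Algebra.Coset" "HOL-Algebra.Lattice"
begin

locale inverse_monoid = monoid G for G (structure) +
  assumes ex1_inverse:
    "x \<in> carrier G \<Longrightarrow> \<exists>!y. y \<in> carrier G \<and> x \<otimes> y \<otimes> x = x \<and> y \<otimes> x \<otimes> y = y"

text \<open>The inverse in the sense of inverse monoids; it differs from \<^const>\<open>m_inv\<close>, which
  requires the two products to be the unit.\<close>

definition inverse_of :: "('a, 'm) monoid_scheme \<Rightarrow> 'a \<Rightarrow> 'a" where
  "inverse_of M x =
     (THE y. y \<in> carrier M \<and> x \<otimes>\<^bsub>M\<^esub> y \<otimes>\<^bsub>M\<^esub> x = x \<and> y \<otimes>\<^bsub>M\<^esub> x \<otimes>\<^bsub>M\<^esub> y = y)"

definition idems :: "('a, 'm) monoid_scheme \<Rightarrow> 'a set" where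
  "idems M = {e \<in> carrier M. e \<otimes>\<^bsub>M\<^esub> e = e}"

definition nat_order :: "('a, 'm) monoid_scheme \<Rightarrow> 'a gorder" where
  "nat_order M = \<lparr>carrier = carrier M, eq = (=), le = (\<lambda>a b. \<exists>e \<in> idems M. a = e \<otimes>\<^bsub>M\<^esub> b)\<rparr>"

definition maximal_elems :: "('a, 'm) monoid_scheme \<Rightarrow> 'a set \<Rightarrow> 'a set" where
  "maximal_elems M S = {x \<in> S. \<forall>y \<in> S. x \<sqsubseteq>\<^bsub>nat_order M\<^esub> y \<longrightarrow> y = x}"

definition E_unitary :: "('a, 'm) monoid_scheme \<Rightarrow> bool" where
  "E_unitary M \<longleftrightarrow>
     (\<forall>e \<in> idems M. \<forall>x \<in> carrier M. e \<sqsubseteq>\<^bsub>nat_order M\<^esub> x \<longrightarrow> x \<in> idems M)"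

definition finite_above :: "('a, 'm) monoid_scheme \<Rightarrow> bool" where
  "finite_above M \<longleftrightarrow> (\<forall>m \<in> carrier M. finite {n \<in> carrier M. m \<sqsubseteq>\<^bsub>nat_order M\<^esub> n})"

definition congruence :: "('a, 'm) monoid_scheme \<Rightarrow> ('a \<times> 'a) set \<Rightarrow> bool" where
  "congruence M r \<longleftrightarrow> equiv (carrier M) r \<and>
     (\<forall>a b c d. (a, b) \<in> r \<longrightarrow> (c, d) \<in> r \<longrightarrow> (a \<otimes>\<^bsub>M\<^esub> c, b \<otimes>\<^bsub>M\<^esub> d) \<in> r)"

text \<open>For a congruence \<open>r\<close>, the set \<open>r `` (A <#> B)\<close> is the class of the products of elements of
  the classes \<open>A\<close> and \<open>B\<close>.\<close>

definition quotient_monoid :: "('a, 'm) monoid_scheme \<Rightarrow> ('a \<times> 'a) set \<Rightarrow> 'a set monoid" where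
  "quotient_monoid M r =
     \<lparr>carrier = carrier M // r, mult = (\<lambda>A B. r `` (A <#>\<^bsub>M\<^esub> B)), one = r `` {\<one>\<^bsub>M\<^esub>}\<rparr>"

definition group_congruence :: "('a, 'm) monoid_scheme \<Rightarrow> ('a \<times> 'a) set \<Rightarrow> bool" where
  "group_congruence M r \<longleftrightarrow> congruence M r \<and> group (quotient_monoid M r)"

text \<open>On an inverse monoid a least group congruence exists, so \<open>LEAST\<close> (with respect to
  inclusion) is meaningful there.\<close>

definition sigma :: "('a, 'm) monoid_scheme \<Rightarrow> ('a \<times> 'a) set" where
  "sigma M = (LEAST r. group_congruence M r)"

abbreviation max_group_image :: "('a, 'm) monoid_scheme \<Rightarrow> 'a set monoid" where
  "max_group_image M \<equiv> quotient_monoid M (sigma M)"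

definition H_set :: "('a, 'm) monoid_scheme \<Rightarrow> 'a \<Rightarrow> 'a \<Rightarrow> 'a set \<Rightarrow> 'a set" where
  "H_set M a b v =
     {inverse_of M d \<otimes>\<^bsub>M\<^esub> a \<otimes>\<^bsub>M\<^esub> inverse_of M b \<otimes>\<^bsub>M\<^esub> d | d. d \<in> maximal_elems M v}"

definition h_sup :: "('a, 'm) monoid_scheme \<Rightarrow> 'a \<Rightarrow> 'a \<Rightarrow> 'a set \<Rightarrow> 'a" where
  "h_sup M a b v = \<Squnion>\<^bsub>nat_order M\<^esub> (H_set M a b v)"

definition F_inverse_monoid :: "('a, 'm) monoid_scheme \<Rightarrow> bool" where
  "F_inverse_monoid F \<longleftrightarrow> inverse_monoid F \<and>
     (\<forall>v \<in> carrier (max_group_image F). \<exists>g. greatest (nat_order F) g v)"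

text \<open>Members of \<^const>\<open>epi\<close> are only required to preserve products; being surjective, they
  also preserve the unit and inverses.\<close>

definition F_inverse_cover ::
    "('a, 'm) monoid_scheme \<Rightarrow> ('b, 'n) monoid_scheme \<Rightarrow> ('b \<Rightarrow> 'a) \<Rightarrow> bool" where
  "F_inverse_cover M F \<phi> \<longleftrightarrow> F_inverse_monoid F \<and> \<phi> \<in> epi F M \<and> inj_on \<phi> (idems F)"

text \<open>For a homomorphism \<open>\<phi>\<close> from \<open>F\<close> to \<open>M\<close>, the image under \<open>\<phi>\<close> of a class of \<open>sigma F\<close> lies in a
  single class of \<open>sigma M\<close>, which is the value below.\<close>

definition induced_hom :: "('a, 'm) monoid_scheme \<Rightarrow> ('b \<Rightarrow> 'a) \<Rightarrow> 'b set \<Rightarrow> 'a set" where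
  "induced_hom M \<phi> V = sigma M `` (\<phi> ` V)"

definition induced_kernel ::
    "('a, 'm) monoid_scheme \<Rightarrow> ('b, 'n) monoid_scheme \<Rightarrow> ('b \<Rightarrow> 'a) \<Rightarrow> 'b set monoid" where
  "induced_kernel M F \<phi> = (max_group_image F)
     \<lparr>carrier := kernel (max_group_image F) (max_group_image M) (induced_hom M \<phi>)\<rparr>"

definition F_inverse_cover_via ::
    "('b set monoid \<Rightarrow> bool) \<Rightarrow> ('a, 'm) monoid_scheme \<Rightarrow> ('b, 'n) monoid_scheme \<Rightarrow>
      ('b \<Rightarrow> 'a) \<Rightarrow> bool" where
  "F_inverse_cover_via D M F \<phi> \<longleftrightarrow> F_inverse_cover M F \<phi> \<and> D (induced_kernel M F \<phi>)"

end

theory Submission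
  imports Defs
begin

text \<open>Write \<open>A\<close>, \<open>B\<close>, \<open>C\<close>, \<open>D\<close> for the greatest elements of \<open>\<sigma>\<close>-classes of the cover \<open>F\<close>
  which lie over \<open>a\<close>, \<open>b\<close>, \<open>c\<close> and over an arbitrary \<open>d \<in> max v\<close>. The classes of \<open>A B\<^sup>-\<^sup>1\<close> and
  \<open>D C\<^sup>-\<^sup>1\<close> belong to the kernel \<open>N\<close>. If \<open>N\<close> is Abelian, they commute, so the class of
  \<open>D\<^sup>-\<^sup>1 A B\<^sup>-\<^sup>1 D\<close> does not depend on \<open>d\<close>. The image in \<open>M\<close> of its greatest element \<open>P\<close> is
  therefore an upper bound of \<open>H(a,b;v)\<close>, so it lies above \<open>h(a,b;v)\<close>. Since \<open>C P C\<^sup>-\<^sup>1 B\<close> is in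
  the class of \<open>A\<close>, it lies below \<open>A\<close>, and hence \<open>c h(a,b;v) c\<^sup>-\<^sup>1 b \<le> a\<close>.\<close>

section \<open>Inverse monoids\<close>

context inverse_monoid
begin

abbreviation \<iota> :: "'a \<Rightarrow> 'a" where "\<iota> x \<equiv> inverse_of G x"

lemma inverse_of_props:
  assumes "x \<in> carrier G"
  shows "\<iota> x \<in> carrier G" "x \<otimes> \<iota> x \<otimes> x = x" "\<iota> x \<otimes> x \<otimes> \<iota> x = \<iota> x"
  using theI'[OF ex1_inverse[OF assms]] unfolding inverse_of_def by blast+

lemmas inverse_of_closed [simp, intro] = inverse_of_props(1)

lemma inverse_of_eqI:
  assumes "x \<in> carrier G" "y \<in> carrier G" "x \<otimes> y \<otimes> x = x" "y \<otimes> x \<otimes> y = y"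
  shows "\<iota> x = y"
  unfolding inverse_of_def using ex1_inverse[OF assms(1)] assms by (intro the1_equality) auto

lemma inverse_of_inverse_of:
  assumes "x \<in> carrier G"
  shows "\<iota> (\<iota> x) = x"
  using assms by (intro inverse_of_eqI) (auto simp: inverse_of_props)

lemma idems_closed [intro]: "e \<in> idems G \<Longrightarrow> e \<in> carrier G"
  by (simp add: idems_def)

lemma idems_idem: "e \<in> idems G \<Longrightarrow> e \<otimes> e = e"
  by (simp add: idems_def)

lemma one_idems: "\<one> \<in> idems G"
  by (simp add: idems_def)

lemma inverse_of_idem:
  assumes "e \<in> idems G"
  shows "\<iota> e = e"
  using assms by (intro inverse_of_eqI) (auto simp: idems_def)

text \<open>If \<open>x\<close> is the inverse of \<open>ef\<close>, then \<open>fxe\<close> is an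
  inverse of \<open>ef\<close> too, so \<open>x = fxe\<close> by uniqueness. Then
  \<open>xx = f(xefx)e = fxe = x\<close>. An idempotent is its own inverse, so \<open>ef\<close>,
  being the inverse of \<open>x\<close>, equals \<open>x\<close>.\<close>

lemma idems_mult:
  assumes e: "e \<in> idems G" and f: "f \<in> idems G"
  shows "e \<otimes> f \<in> idems G"
proof -
  have c: "e \<in> carrier G" "f \<in> carrier G" using assms by auto
  define x where "x = \<iota> (e \<otimes> f)"
  have x: "x \<in> carrier G" using c by (simp add: x_def)
  have 1: "e \<otimes> f \<otimes> x \<otimes> (e \<otimes> f) = e \<otimes> f" and 2: "x \<otimes> (e \<otimes> f) \<otimes> x = x"
    using inverse_of_props[of "e \<otimes> f"] c by (auto simp: x_def)
  have ee: "e \<otimes> (e \<otimes> z) = e \<otimes> z" and ff: "f \<otimes> (f \<otimes> z) = f \<otimes> z" if "z \<in> carrier G" for z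
    using that c e f by (simp_all add: m_assoc[symmetric] idems_idem)
  \<comment> \<open>This is \<open>x(ef)x = x\<close> multiplied by \<open>f\<close> on the left and
    \<open>e\<close> on the right. It serves twice: for the second inverse law of \<open>fxe\<close>
    and for \<open>xx = x\<close>.\<close>
  have fxef: "f \<otimes> (x \<otimes> (e \<otimes> (f \<otimes> (x \<otimes> e)))) = f \<otimes> (x \<otimes> e)"
    using arg_cong[OF 2, of "\<lambda>z. f \<otimes> (z \<otimes> e)"] c x by (simp add: m_assoc)
  have "x = f \<otimes> (x \<otimes> e)"
    unfolding x_def
  proof (rule inverse_of_eqI)
    show "e \<otimes> f \<otimes> (f \<otimes> (\<iota> (e \<otimes> f) \<otimes> e)) \<otimes> (e \<otimes> f) = e \<otimes> f"
      using 1 c x unfolding x_def[symmetric] by (simp add: m_assoc ee ff)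
    show "f \<otimes> (\<iota> (e \<otimes> f) \<otimes> e) \<otimes> (e \<otimes> f) \<otimes> (f \<otimes> (\<iota> (e \<otimes> f) \<otimes> e)) = f \<otimes> (\<iota> (e \<otimes> f) \<otimes> e)"
      using fxef c x unfolding x_def[symmetric] by (simp add: m_assoc ee ff)
  qed (use c x in \<open>auto simp: x_def\<close>)
  then have "x \<otimes> x = x"
    using fxef c x by (metis m_assoc m_closed)
  then have "x \<in> idems G" using x by (simp add: idems_def)
  moreover have "\<iota> x = e \<otimes> f" unfolding x_def using c by (simp add: inverse_of_inverse_of)
  ultimately show ?thesis by (simp add: inverse_of_idem)
qed

text \<open>Since \<open>ef\<close> and \<open>fe\<close> are both idempotent, \<open>fe\<close> is
  an inverse of \<open>ef\<close>; but \<open>ef\<close> is its own inverse, and inverses are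
  unique.\<close>

lemma idems_commute:
  assumes e: "e \<in> idems G" and f: "f \<in> idems G"
  shows "e \<otimes> f = f \<otimes> e"
proof -
  have c: "e \<in> carrier G" "f \<in> carrier G" using assms by auto
  have ee: "e \<otimes> (e \<otimes> z) = e \<otimes> z" and ff: "f \<otimes> (f \<otimes> z) = f \<otimes> z" if "z \<in> carrier G" for z
    using that c e f by (simp_all add: m_assoc[symmetric] idems_idem)
  have "e \<otimes> f \<otimes> (e \<otimes> f) = e \<otimes> f" "f \<otimes> e \<otimes> (f \<otimes> e) = f \<otimes> e"
    using idems_mult[OF e f] idems_mult[OF f e] by (simp_all add: idems_idem)
  then have "\<iota> (e \<otimes> f) = f \<otimes> e"
    using c by (intro inverse_of_eqI) (auto simp: m_assoc ee ff)
  then show ?thesis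
    using inverse_of_idem[OF idems_mult[OF e f]] by simp
qed

lemma mult_inverse_of_idems:
  assumes "x \<in> carrier G"
  shows "x \<otimes> \<iota> x \<in> idems G" "\<iota> x \<otimes> x \<in> idems G"
  using assms inverse_of_props[OF assms] by (simp_all add: idems_def m_assoc[symmetric])

text \<open>The idempotents \<open>y y^-1\<close> and \<open>x^-1 x\<close> meet in the middle of
  both inverse laws; swapping them splits the product into one law for \<open>x\<close> and one for
  \<open>y\<close>.\<close>

lemma inverse_of_mult:
  assumes x: "x \<in> carrier G" and y: "y \<in> carrier G"
  shows "\<iota> (x \<otimes> y) = \<iota> y \<otimes> \<iota> x"
proof (rule inverse_of_eqI)
  have comm: "y \<otimes> \<iota> y \<otimes> (\<iota> x \<otimes> x) = \<iota> x \<otimes> x \<otimes> (y \<otimes> \<iota> y)"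
    using x y by (intro idems_commute mult_inverse_of_idems)
  have "x \<otimes> y \<otimes> (\<iota> y \<otimes> \<iota> x) \<otimes> (x \<otimes> y) = x \<otimes> (y \<otimes> \<iota> y \<otimes> (\<iota> x \<otimes> x)) \<otimes> y"
    using x y by (simp add: m_assoc)
  also have "\<dots> = (x \<otimes> \<iota> x \<otimes> x) \<otimes> (y \<otimes> \<iota> y \<otimes> y)"
    unfolding comm using x y by (simp add: m_assoc)
  finally show "x \<otimes> y \<otimes> (\<iota> y \<otimes> \<iota> x) \<otimes> (x \<otimes> y) = x \<otimes> y"
    using x y by (simp add: inverse_of_props)
  have "\<iota> y \<otimes> \<iota> x \<otimes> (x \<otimes> y) \<otimes> (\<iota> y \<otimes> \<iota> x) = \<iota> y \<otimes> (\<iota> x \<otimes> x \<otimes> (y \<otimes> \<iota> y)) \<otimes> \<iota> x"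
    using x y by (simp add: m_assoc)
  also have "\<dots> = (\<iota> y \<otimes> y \<otimes> \<iota> y) \<otimes> (\<iota> x \<otimes> x \<otimes> \<iota> x)"
    unfolding comm[symmetric] using x y by (simp add: m_assoc)
  finally show "\<iota> y \<otimes> \<iota> x \<otimes> (x \<otimes> y) \<otimes> (\<iota> y \<otimes> \<iota> x) = \<iota> y \<otimes> \<iota> x"
    using x y by (simp add: inverse_of_props)
qed (use x y in auto)

text \<open>Turns a right idempotent factor into a left one, as the natural order and
  \<open>idem_rel\<close> require: write \<open>x = x x^-1 x\<close> and let \<open>e\<close>
  commute with \<open>x^-1 x\<close>.\<close>

lemma mult_idem_shift:
  assumes x: "x \<in> carrier G" and e: "e \<in> idems G"
  shows "x \<otimes> e = x \<otimes> e \<otimes> \<iota> x \<otimes> x"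
proof -
  have c: "e \<in> carrier G" using e by auto
  have "x \<otimes> e = x \<otimes> (\<iota> x \<otimes> x \<otimes> e)"
    using x c inverse_of_props[OF x] by (simp add: m_assoc[symmetric])
  also have "\<iota> x \<otimes> x \<otimes> e = e \<otimes> (\<iota> x \<otimes> x)"
    using x e by (intro idems_commute mult_inverse_of_idems)
  also have "x \<otimes> (e \<otimes> (\<iota> x \<otimes> x)) = x \<otimes> e \<otimes> \<iota> x \<otimes> x"
    using x c by (simp add: m_assoc)
  finally show ?thesis .
qed

lemma conj_idems:
  assumes x: "x \<in> carrier G" and e: "e \<in> idems G"
  shows "x \<otimes> e \<otimes> \<iota> x \<in> idems G"
proof -
  have c: "e \<in> carrier G" using e by auto
  have "x \<otimes> e \<otimes> \<iota> x \<otimes> (x \<otimes> e \<otimes> \<iota> x) = (x \<otimes> e \<otimes> \<iota> x \<otimes> x) \<otimes> e \<otimes> \<iota> x"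
    using x c by (simp add: m_assoc)
  also have "\<dots> = x \<otimes> (e \<otimes> e) \<otimes> \<iota> x"
    unfolding mult_idem_shift[OF x e, symmetric] using x c by (simp add: m_assoc)
  finally show ?thesis using x c e by (simp add: idems_def)
qed

section \<open>The natural partial order and its compatibility with products\<close>

lemma nat_order_le_iff: "a \<sqsubseteq>\<^bsub>nat_order G\<^esub> b \<longleftrightarrow> (\<exists>e \<in> idems G. a = e \<otimes> b)"
  by (simp add: nat_order_def)

lemma carrier_nat_order [simp]: "carrier (nat_order G) = carrier G"
  by (simp add: nat_order_def)

lemma nat_order_trans:
  assumes "a \<sqsubseteq>\<^bsub>nat_order G\<^esub> b" "b \<sqsubseteq>\<^bsub>nat_order G\<^esub> c" "c \<in> carrier G"
  shows "a \<sqsubseteq>\<^bsub>nat_order G\<^esub> c"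
proof -
  obtain e f where "e \<in> idems G" "f \<in> idems G" "a = e \<otimes> b" "b = f \<otimes> c"
    using assms unfolding nat_order_le_iff by blast
  then have "e \<otimes> f \<in> idems G" "a = e \<otimes> f \<otimes> c"
    using assms(3) by (auto simp: idems_mult m_assoc idems_closed)
  then show ?thesis unfolding nat_order_le_iff by blast
qed

text \<open>The order has its idempotent on the left, so in \<open>c e b\<close> the factor
  \<open>e\<close> must be moved past \<open>c\<close>, where it becomes
  \<open>c e c^-1\<close>.\<close>

lemma nat_order_mult_left:
  assumes "a \<sqsubseteq>\<^bsub>nat_order G\<^esub> b" "b \<in> carrier G" "c \<in> carrier G"
  shows "c \<otimes> a \<sqsubseteq>\<^bsub>nat_order G\<^esub> c \<otimes> b"
proof -
  obtain e where e: "e \<in> idems G" "a = e \<otimes> b"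
    using assms unfolding nat_order_le_iff by blast
  have "c \<otimes> a = c \<otimes> e \<otimes> b" using e assms by (simp add: m_assoc idems_closed)
  also have "\<dots> = c \<otimes> e \<otimes> \<iota> c \<otimes> c \<otimes> b"
    by (simp only: mult_idem_shift[OF assms(3) e(1), symmetric])
  also have "\<dots> = c \<otimes> e \<otimes> \<iota> c \<otimes> (c \<otimes> b)"
    using e assms by (simp add: m_assoc idems_closed)
  finally show ?thesis
    using conj_idems[OF assms(3) e(1)] unfolding nat_order_le_iff by blast
qed

lemma nat_order_mult_right:
  assumes "a \<sqsubseteq>\<^bsub>nat_order G\<^esub> b" "b \<in> carrier G" "c \<in> carrier G"
  shows "a \<otimes> c \<sqsubseteq>\<^bsub>nat_order G\<^esub> b \<otimes> c"
  using assms unfolding nat_order_le_iff by (auto simp: m_assoc idems_closed)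

lemma idem_mult_le:
  assumes "e \<in> idems G" "f \<in> idems G"
  shows "e \<otimes> f \<sqsubseteq>\<^bsub>nat_order G\<^esub> e" "e \<otimes> f \<sqsubseteq>\<^bsub>nat_order G\<^esub> f"
  using assms idems_commute[OF assms] unfolding nat_order_le_iff by blast+

end

section \<open>The least group congruence\<close>

lemma congruenceD:
  assumes "congruence M r"
  shows "equiv (carrier M) r"
    and "(a, b) \<in> r \<Longrightarrow> (c, d) \<in> r \<Longrightarrow> (a \<otimes>\<^bsub>M\<^esub> c, b \<otimes>\<^bsub>M\<^esub> d) \<in> r"
  using assms unfolding congruence_def by blast+

text \<open>The quotient product saturates the set of products of representatives; compatibility
  puts all of these into one class, so the product can be computed on representatives.\<close>

lemma (in monoid) quotient_monoid_mult_class: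
  assumes r: "congruence G r" and x: "x \<in> carrier G" and y: "y \<in> carrier G"
  shows "r `` {x} \<otimes>\<^bsub>quotient_monoid G r\<^esub> r `` {y} = r `` {x \<otimes> y}"
proof -
  have eq: "equiv (carrier G) r" using r by (rule congruenceD)
  have "r `` (r `` {x} <#> r `` {y}) = r `` {x \<otimes> y}"
  proof (intro equalityI subsetI)
    fix z assume "z \<in> r `` (r `` {x} <#> r `` {y})"
    then obtain s t where st: "(x, s) \<in> r" "(y, t) \<in> r" "(s \<otimes> t, z) \<in> r"
      by (auto simp: set_mult_def)
    then have "(x \<otimes> y, s \<otimes> t) \<in> r" using congruenceD(2)[OF r] by blast
    then show "z \<in> r `` {x \<otimes> y}" using st eq by (meson Image_singleton_iff equivE transD)
  next
    fix z assume "z \<in> r `` {x \<otimes> y}"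
    moreover have "x \<in> r `` {x}" "y \<in> r `` {y}" using equiv_class_self[OF eq] x y by blast+
    ultimately show "z \<in> r `` (r `` {x} <#> r `` {y})" by (auto simp: set_mult_def)
  qed
  then show ?thesis by (simp add: quotient_monoid_def)
qed

context inverse_monoid
begin

text \<open>The usual explicit form of the least group congruence; \<open>sigma_eq\<close> uses it
  to evaluate the \<open>LEAST\<close> in \<open>sigma\<close>.\<close>

definition idem_rel :: "('a \<times> 'a) set" where
  "idem_rel = {(a, b). a \<in> carrier G \<and> b \<in> carrier G \<and> (\<exists>e \<in> idems G. e \<otimes> a = e \<otimes> b)}"

lemma idem_relI: "a \<in> carrier G \<Longrightarrow> b \<in> carrier G \<Longrightarrow> e \<in> idems G \<Longrightarrow> e \<otimes> a = e \<otimes> b \<Longrightarrow> (a, b) \<in> idem_rel"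
  unfolding idem_rel_def by blast

lemma idem_rel_equiv: "equiv (carrier G) idem_rel"
proof (rule equivI)
  show "idem_rel \<subseteq> carrier G \<times> carrier G" by (auto simp: idem_rel_def)
  show "refl_on (carrier G) idem_rel"
    using one_idems by (auto simp: refl_on_def idem_rel_def)
  show "sym idem_rel" unfolding idem_rel_def by (rule symI) (simp, metis)
  show "trans idem_rel"
  proof (rule transI)
    fix a b c assume "(a, b) \<in> idem_rel" "(b, c) \<in> idem_rel"
    then obtain e f where *: "a \<in> carrier G" "b \<in> carrier G" "c \<in> carrier G"
      "e \<in> idems G" "f \<in> idems G" "e \<otimes> a = e \<otimes> b" "f \<otimes> b = f \<otimes> c"
      unfolding idem_rel_def by blast
    then have c: "e \<in> carrier G" "f \<in> carrier G" by auto
    \<comment> \<open>The witness is \<open>f e\<close>: as \<open>e\<close> and \<open>f\<close>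
      commute, it can absorb either of the two equations.\<close>
    have "f \<otimes> e \<otimes> a = f \<otimes> e \<otimes> b" using * c by (simp add: m_assoc)
    also have "\<dots> = e \<otimes> f \<otimes> b" using * by (simp add: idems_commute)
    also have "\<dots> = e \<otimes> f \<otimes> c" using * c by (simp add: m_assoc)
    also have "\<dots> = f \<otimes> e \<otimes> c" using * by (simp add: idems_commute)
    finally show "(a, c) \<in> idem_rel" using * by (intro idem_relI[of a c "f \<otimes> e"] idems_mult)
  qed
qed

lemma idem_rel_congruence: "congruence G idem_rel"
  unfolding congruence_def
proof (intro conjI allI impI idem_rel_equiv)
  fix a b c d assume "(a, b) \<in> idem_rel" "(c, d) \<in> idem_rel"
  then obtain e f where *: "a \<in> carrier G" "b \<in> carrier G" "c \<in> carrier G" "d \<in> carrier G"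
      "e \<in> idems G" "f \<in> idems G" "e \<otimes> a = e \<otimes> b" "f \<otimes> c = f \<otimes> d"
    unfolding idem_rel_def by blast
  then have cl: "e \<in> carrier G" "f \<in> carrier G" by auto
  \<comment> \<open>Multiplying \<open>a c\<close> by \<open>e\<close> leaves \<open>f\<close> stuck
    to the right of \<open>a\<close>; the conjugate of \<open>f\<close> by \<open>e x\<close>
    carries it to the left. The resulting value \<open>(e x)(f y)\<close> depends only on
    \<open>e x\<close> and \<open>f y\<close>, and \<open>g a = g b\<close> because
    \<open>e a = e b\<close>.\<close>
  define g where "g x = (e \<otimes> x) \<otimes> f \<otimes> \<iota> (e \<otimes> x)" for x
  have g: "g x \<otimes> (x \<otimes> y) = e \<otimes> x \<otimes> (f \<otimes> y)" if "x \<in> carrier G" "y \<in> carrier G" for x y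
  proof -
    have "\<iota> (e \<otimes> x) = \<iota> x \<otimes> e"
      using that cl * by (simp add: inverse_of_mult inverse_of_idem)
    then have "g x \<otimes> (x \<otimes> y) = g x \<otimes> (e \<otimes> x) \<otimes> y"
      using that cl * by (simp add: g_def m_assoc) (simp add: m_assoc[symmetric] idems_idem)
    also have "g x \<otimes> (e \<otimes> x) = e \<otimes> x \<otimes> f"
      unfolding g_def using mult_idem_shift[of "e \<otimes> x" f] that cl * by simp
    finally show ?thesis using that cl by (simp add: m_assoc)
  qed
  have "g a \<otimes> (a \<otimes> c) = g a \<otimes> (b \<otimes> d)"
    using g[of a c] g[of b d] * by (simp add: g_def)
  moreover have "g a \<in> idems G" using * cl by (simp add: g_def conj_idems)
  ultimately show "(a \<otimes> c, b \<otimes> d) \<in> idem_rel" using * by (intro idem_relI) auto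
qed

lemma mult_inverse_of_idem_rel:
  assumes "x \<in> carrier G"
  shows "(x \<otimes> \<iota> x, \<one>) \<in> idem_rel" "(\<iota> x \<otimes> x, \<one>) \<in> idem_rel"
  using assms mult_inverse_of_idems[OF assms]
  by (auto intro: idem_relI[of _ _ "x \<otimes> \<iota> x"] simp: idems_idem)
    (auto intro: idem_relI[of _ _ "\<iota> x \<otimes> x"] simp: idems_idem)

lemma idem_rel_group: "group (quotient_monoid G idem_rel)" (is "group ?Q")
proof -
  note mult = quotient_monoid_mult_class[OF idem_rel_congruence]
  have carr: "X \<in> carrier ?Q \<longleftrightarrow> (\<exists>x\<in>carrier G. X = idem_rel `` {x})" for X
    by (auto simp: quotient_monoid_def quotient_def)
  have one: "\<one>\<^bsub>?Q\<^esub> = idem_rel `` {\<one>}" by (simp add: quotient_monoid_def)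
  show ?thesis
  proof (rule groupI)
    fix X assume "X \<in> carrier ?Q"
    then obtain x where x: "x \<in> carrier G" "X = idem_rel `` {x}" by (auto simp: carr)
    have "idem_rel `` {\<iota> x \<otimes> x} = idem_rel `` {\<one>}"
      using equiv_class_eq[OF idem_rel_equiv mult_inverse_of_idem_rel(2)[OF x(1)]] .
    then show "\<exists>Y\<in>carrier ?Q. Y \<otimes>\<^bsub>?Q\<^esub> X = \<one>\<^bsub>?Q\<^esub>"
      using x by (intro bexI[of _ "idem_rel `` {\<iota> x}"]) (auto simp: mult one carr)
  qed (auto simp: carr mult one m_assoc)
qed

text \<open>The only idempotent of a group is its identity, so \<open>r\<close> relates each
  idempotent to \<open>\<one>\<close> and hence \<open>e x\<close> to \<open>x\<close>. Then
  \<open>a\<close>, \<open>e a = e b\<close> and \<open>b\<close> lie in one class.\<close>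

lemma idem_rel_least:
  assumes "group_congruence G r"
  shows "idem_rel \<subseteq> r"
proof
  have r: "congruence G r" and grp: "group (quotient_monoid G r)"
    using assms by (auto simp: group_congruence_def)
  interpret Q: group "quotient_monoid G r" by (rule grp)
  note eq = congruenceD(1)[OF r]
  have e1: "(e, \<one>) \<in> r" if e: "e \<in> idems G" for e
  proof -
    let ?E = "r `` {e}"
    have c: "e \<in> carrier G" using e by auto
    then have E: "?E \<in> carrier (quotient_monoid G r)"
      by (auto simp: quotient_monoid_def quotient_def)
    have "?E \<otimes>\<^bsub>quotient_monoid G r\<^esub> ?E = ?E"
      using c e by (simp add: quotient_monoid_mult_class[OF r] idems_idem)
    then have "?E = \<one>\<^bsub>quotient_monoid G r\<^esub>" using E by simp
    then have "?E = r `` {\<one>}" by (simp add: quotient_monoid_def)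
    then show ?thesis using eq c by (simp add: eq_equiv_class_iff)
  qed
  fix p assume "p \<in> idem_rel"
  then obtain a b e where *: "p = (a, b)" "a \<in> carrier G" "b \<in> carrier G"
    "e \<in> idems G" "e \<otimes> a = e \<otimes> b"
    unfolding idem_rel_def by blast
  have "(e \<otimes> x, x) \<in> r" if "x \<in> carrier G" for x
    using congruenceD(2)[OF r e1[OF *(4)], of x x] equiv_class_self[OF eq that] that by simp
  then show "p \<in> r"
    using * eq by (metis equivE symD transD)
qed

lemma sigma_eq: "sigma G = idem_rel"
  unfolding sigma_def
  by (rule Least_equality)
    (use idem_rel_least idem_rel_congruence idem_rel_group in \<open>auto simp: group_congruence_def\<close>)

section \<open>Computing with the classes of \<open>sigma\<close>, and consequences of being
  \<open>E\<close>-unitary or \<open>F\<close>-inverse\<close>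

lemma sigma_iff:
  "(a, b) \<in> sigma G \<longleftrightarrow> a \<in> carrier G \<and> b \<in> carrier G \<and> (\<exists>e \<in> idems G. e \<otimes> a = e \<otimes> b)"
  by (simp add: sigma_eq idem_rel_def)

lemma sigma_equiv: "equiv (carrier G) (sigma G)"
  by (simp add: sigma_eq idem_rel_equiv)

lemma sigma_congruence: "congruence G (sigma G)"
  by (simp add: sigma_eq idem_rel_congruence)

lemma group_max_group_image: "group (max_group_image G)"
  by (simp add: sigma_eq idem_rel_group)

lemma carrier_max_group_image: "carrier (max_group_image G) = (\<lambda>x. sigma G `` {x}) ` carrier G"
  by (auto simp: quotient_monoid_def quotient_def)

lemma one_max_group_image: "\<one>\<^bsub>max_group_image G\<^esub> = sigma G `` {\<one>}"
  by (simp add: quotient_monoid_def)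

lemma sigma_class_closed: "x \<in> carrier G \<Longrightarrow> sigma G `` {x} \<in> carrier (max_group_image G)"
  by (simp add: carrier_max_group_image)

lemma sigma_class_eq_iff:
  "x \<in> carrier G \<Longrightarrow> y \<in> carrier G \<Longrightarrow> sigma G `` {x} = sigma G `` {y} \<longleftrightarrow> (x, y) \<in> sigma G"
  using sigma_equiv by (simp add: eq_equiv_class_iff)

lemma sigma_class_mult:
  "x \<in> carrier G \<Longrightarrow> y \<in> carrier G \<Longrightarrow>
    sigma G `` {x \<otimes> y} = sigma G `` {x} \<otimes>\<^bsub>max_group_image G\<^esub> sigma G `` {y}"
  by (simp add: quotient_monoid_mult_class[OF sigma_congruence])

text \<open>Links the two notions of inverse: \<open>x^-1 x\<close> is idempotent, so its class is
  the identity, and in a group a left inverse is the inverse.\<close>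

lemma sigma_class_inverse_of:
  assumes "x \<in> carrier G"
  shows "sigma G `` {\<iota> x} = inv\<^bsub>max_group_image G\<^esub> (sigma G `` {x})"
proof -
  interpret Q: group "max_group_image G" by (rule group_max_group_image)
  have "sigma G `` {\<iota> x \<otimes> x} = sigma G `` {\<one>}"
    using assms mult_inverse_of_idem_rel(2)[OF assms]
    by (simp add: sigma_class_eq_iff[unfolded sigma_eq] sigma_eq)
  then show ?thesis
    using assms
    by (intro Q.inv_equality[symmetric])
      (simp_all add: sigma_class_mult one_max_group_image sigma_class_closed)
qed

text \<open>From \<open>e x = e y\<close> with \<open>y\<close> idempotent, the idempotent
  \<open>e y\<close> lies below \<open>x\<close>.\<close>

lemma E_unitary_sigma_idem:
  assumes "E_unitary G" "(x, y) \<in> sigma G" "y \<in> idems G"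
  shows "x \<in> idems G"
proof -
  obtain e where e: "x \<in> carrier G" "e \<in> idems G" "e \<otimes> x = e \<otimes> y"
    using assms(2) unfolding sigma_iff by blast
  then have "e \<otimes> y \<sqsubseteq>\<^bsub>nat_order G\<^esub> x" unfolding nat_order_le_iff by metis
  moreover have "e \<otimes> y \<in> idems G" using e assms by (simp add: idems_mult)
  ultimately show ?thesis using assms(1) e unfolding E_unitary_def by blast
qed

lemma idem_sigma_one:
  assumes "e \<in> idems G"
  shows "(e, \<one>) \<in> sigma G"
  using assms by (auto simp: sigma_iff idems_idem idems_closed intro!: bexI[of _ e])

text \<open>Multiplying by \<open>b^-1\<close> relates \<open>a b^-1\<close> to the idempotent
  \<open>b b^-1\<close>.\<close>

lemma E_unitary_mult_inverse_of_idem: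
  assumes "E_unitary G" "(a, b) \<in> sigma G"
  shows "a \<otimes> \<iota> b \<in> idems G"
proof -
  have b: "b \<in> carrier G" using assms(2) by (simp add: sigma_iff)
  then have "(a \<otimes> \<iota> b, b \<otimes> \<iota> b) \<in> sigma G"
    using congruenceD(2)[OF sigma_congruence assms(2)] equiv_class_self[OF sigma_equiv] by blast
  then show ?thesis using E_unitary_sigma_idem[OF assms(1)] mult_inverse_of_idems(1)[OF b] by blast
qed

text \<open>Phrased with equality of classes, so that an element can be put below \<open>g\<close>
  by a calculation in the maximal group image.\<close>

lemma F_inverse_class_greatest:
  assumes "F_inverse_monoid G" and x: "x \<in> carrier G"
  shows "\<exists>g\<in>carrier G. sigma G `` {g} = sigma G `` {x} \<and>
    (\<forall>y\<in>carrier G. sigma G `` {y} = sigma G `` {x} \<longrightarrow> y \<sqsubseteq>\<^bsub>nat_order G\<^esub> g)"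
proof -
  obtain g where "greatest (nat_order G) g (sigma G `` {x})"
    using assms sigma_class_closed unfolding F_inverse_monoid_def by blast
  then have xg: "(x, g) \<in> sigma G" and gr: "\<And>y. (x, y) \<in> sigma G \<Longrightarrow> y \<sqsubseteq>\<^bsub>nat_order G\<^esub> g"
    by (auto simp: greatest_def)
  have "g \<in> carrier G" using xg by (simp add: sigma_iff)
  moreover have "sigma G `` {g} = sigma G `` {x}"
    using equiv_class_eq[OF sigma_equiv xg] by simp
  moreover have "y \<sqsubseteq>\<^bsub>nat_order G\<^esub> g" if "y \<in> carrier G" "sigma G `` {y} = sigma G `` {x}" for y
    using that x gr sigma_class_eq_iff[of x y] by simp
  ultimately show ?thesis by blast
qed

section \<open>Suprema of sets of idempotents\<close>

text \<open>The upper bounds form a finite set, all lying above one element of \<open>H\<close>.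
  They are idempotent since \<open>G\<close> is \<open>E\<close>-unitary, they include
  \<open>\<one>\<close>, and they are closed under products. The product of two idempotents is below
  both, so multiplying all upper bounds together gives the least one.\<close>

lemma least_Upper_idems:
  assumes fa: "finite_above G" and eu: "E_unitary G" and ne: "H \<noteq> {}" and H: "H \<subseteq> idems G"
  shows "\<exists>h. least (nat_order G) h (Upper (nat_order G) H)"
proof -
  define U where "U = Upper (nat_order G) H"
  have U: "x \<in> U \<longleftrightarrow> x \<in> carrier G \<and> (\<forall>h\<in>H. h \<sqsubseteq>\<^bsub>nat_order G\<^esub> x)" for x
    using H unfolding U_def Upper_def by auto
  obtain h0 where h0: "h0 \<in> H" using ne by blast
  have "U \<subseteq> {n \<in> carrier G. h0 \<sqsubseteq>\<^bsub>nat_order G\<^esub> n}" using h0 by (auto simp: U)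
  then have fin: "finite U"
    using fa h0 H unfolding finite_above_def by (meson finite_subset idems_closed subsetD)
  have idem: "x \<in> idems G" if "x \<in> U" for x
    using that h0 H eu unfolding E_unitary_def by (auto simp: U)
  have mult: "x \<otimes> y \<in> U" if xy: "x \<in> U" "y \<in> U" for x y
  proof -
    have c: "x \<in> carrier G" "y \<in> carrier G" using xy by (auto simp: U)
    have "h \<sqsubseteq>\<^bsub>nat_order G\<^esub> x \<otimes> y" if h: "h \<in> H" for h
    proof -
      have hi: "h \<in> idems G" using h H by auto
      \<comment> \<open>Closure under products rests on the chain
        \<open>h = hh \<le> xh \<le> xy\<close>.\<close>
      have "h \<otimes> h \<sqsubseteq>\<^bsub>nat_order G\<^esub> x \<otimes> h"
        using xy h hi c by (intro nat_order_mult_right) (auto simp: U)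
      moreover have "x \<otimes> h \<sqsubseteq>\<^bsub>nat_order G\<^esub> x \<otimes> y"
        using xy h hi c by (intro nat_order_mult_left) (auto simp: U)
      ultimately show ?thesis using hi c nat_order_trans[of "h \<otimes> h" "x \<otimes> h" "x \<otimes> y"]
        by (simp add: idems_idem)
    qed
    then show ?thesis using c by (simp add: U)
  qed
  have one: "\<one> \<in> U" using H unfolding U nat_order_le_iff by (force simp: idems_closed)
  \<comment> \<open>Products over finite subsets of \<open>U\<close>, starting from
    \<open>\<one>\<close>; the case \<open>S = U\<close> yields the least element.\<close>
  have "\<exists>p\<in>U. \<forall>x\<in>S. p \<sqsubseteq>\<^bsub>nat_order G\<^esub> x" if "finite S" "S \<subseteq> U" for S
    using that
  proof (induction S rule: finite_induct)
    case empty
    then show ?case using one by blast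
  next
    case (insert s S)
    then obtain p where p: "p \<in> U" "\<forall>x\<in>S. p \<sqsubseteq>\<^bsub>nat_order G\<^esub> x" by blast
    have s: "s \<in> U" using insert by simp
    have "p \<otimes> s \<sqsubseteq>\<^bsub>nat_order G\<^esub> x" if "x \<in> insert s S" for x
    proof (cases "x = s")
      case True
      then show ?thesis using idem_mult_le(2) idem p s by blast
    next
      case False
      then have "p \<sqsubseteq>\<^bsub>nat_order G\<^esub> x" "x \<in> carrier G" using that p insert by (auto simp: U)
      then show ?thesis using nat_order_trans idem_mult_le(1) idem p s by blast
    qed
    then show ?case using mult[OF p(1) s] by blast
  qed
  from this[OF fin subset_refl] have "\<exists>p. least (nat_order G) p U"
    by (auto simp: least_def U)
  then show ?thesis by (simp add: U_def)
qed

text \<open>The supremum is defined by choice, so existence of a least upper bound suffices. The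
  element \<open>c\<close> shows that \<open>H_set\<close> is nonempty.\<close>

lemma h_sup_least:
  assumes fa: "finite_above G" and eu: "E_unitary G" and ab: "(a, b) \<in> sigma G"
    and v: "v \<subseteq> carrier G" and c: "c \<in> maximal_elems G v"
  shows "least (nat_order G) (h_sup G a b v) (Upper (nat_order G) (H_set G a b v))"
proof -
  have carr: "a \<in> carrier G" "b \<in> carrier G" using ab by (auto simp: sigma_iff)
  have "H_set G a b v \<subseteq> idems G"
  proof
    fix x assume "x \<in> H_set G a b v"
    then obtain d where d: "d \<in> maximal_elems G v" "x = \<iota> d \<otimes> a \<otimes> \<iota> b \<otimes> d"
      unfolding H_set_def by blast
    then have dc: "d \<in> carrier G" using v by (auto simp: maximal_elems_def)
    \<comment> \<open>Elements of \<open>H_set\<close> are conjugates of \<open>a b^-1\<close>,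
      which is idempotent because \<open>a\<close> and \<open>b\<close> are
      \<open>sigma\<close>-related.\<close>
    have "x = \<iota> d \<otimes> (a \<otimes> \<iota> b) \<otimes> \<iota> (\<iota> d)"
      using d dc carr by (simp add: m_assoc inverse_of_inverse_of)
    then show "x \<in> idems G"
      using conj_idems[of "\<iota> d"] dc E_unitary_mult_inverse_of_idem[OF eu ab] by simp
  qed
  moreover have "H_set G a b v \<noteq> {}" using c by (auto simp: H_set_def)
  ultimately obtain h where "least (nat_order G) h (Upper (nat_order G) (H_set G a b v))"
    using least_Upper_idems[OF fa eu] by blast
  then show ?thesis unfolding h_sup_def sup_def by (rule someI)
qed

end

section \<open>Covers\<close>

text \<open>Write \<open>d = (d c^-1) c\<close> and move \<open>d c^-1\<close> past
  \<open>n\<close>. Later \<open>n\<close> and \<open>d c^-1\<close> are in the Abelian kernel,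
  while \<open>c\<close> and \<open>d\<close> may be outside it.\<close>

lemma (in group) conj_eq_of_commute:
  assumes "c \<in> carrier G" "d \<in> carrier G" "n \<in> carrier G"
    and "(d \<otimes> inv c) \<otimes> n = n \<otimes> (d \<otimes> inv c)"
  shows "inv d \<otimes> n \<otimes> d = inv c \<otimes> n \<otimes> c"
proof -
  have "inv d \<otimes> n \<otimes> d = inv d \<otimes> (n \<otimes> (d \<otimes> inv c)) \<otimes> c"
    using assms(1-3) by (simp add: m_assoc)
  also have "\<dots> = inv d \<otimes> d \<otimes> (inv c \<otimes> n \<otimes> c)"
    unfolding assms(4)[symmetric] using assms(1-3) by (simp only: m_assoc m_closed inv_closed)
  finally show ?thesis using assms(1-3) by simp
qed

section \<open>Epimorphisms of inverse monoids and the induced map on maximal group images\<close>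

locale inverse_monoid_epi = F: inverse_monoid F + M: inverse_monoid M
  for F :: "('b, 'n) monoid_scheme" and M :: "('a, 'm) monoid_scheme" +
  fixes \<phi> :: "'b \<Rightarrow> 'a"
  assumes epi: "\<phi> \<in> epi F M"
begin

lemma closed [simp, intro]: "x \<in> carrier F \<Longrightarrow> \<phi> x \<in> carrier M"
  using epi by (auto simp: epi_def hom_def)

lemma mult: "x \<in> carrier F \<Longrightarrow> y \<in> carrier F \<Longrightarrow> \<phi> (x \<otimes>\<^bsub>F\<^esub> y) = \<phi> x \<otimes>\<^bsub>M\<^esub> \<phi> y"
  using epi by (auto simp: epi_def hom_def)

lemma image_idems: "e \<in> idems F \<Longrightarrow> \<phi> e \<in> idems M"
  using mult[of e e] by (auto simp: idems_def)

lemma image_inverse_of: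
  assumes "x \<in> carrier F"
  shows "\<phi> (inverse_of F x) = inverse_of M (\<phi> x)"
proof (rule M.inverse_of_eqI[symmetric])
  show "\<phi> x \<otimes>\<^bsub>M\<^esub> \<phi> (inverse_of F x) \<otimes>\<^bsub>M\<^esub> \<phi> x = \<phi> x"
    "\<phi> (inverse_of F x) \<otimes>\<^bsub>M\<^esub> \<phi> x \<otimes>\<^bsub>M\<^esub> \<phi> (inverse_of F x) = \<phi> (inverse_of F x)"
    using assms by (simp_all add: mult[symmetric] F.inverse_of_props)
qed (use assms in auto)

lemma image_le:
  assumes "x \<sqsubseteq>\<^bsub>nat_order F\<^esub> y" "y \<in> carrier F"
  shows "\<phi> x \<sqsubseteq>\<^bsub>nat_order M\<^esub> \<phi> y"
  using assms image_idems unfolding F.nat_order_le_iff M.nat_order_le_iff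
  by (auto simp: mult F.idems_closed)

lemma image_sigma:
  assumes "(x, y) \<in> sigma F"
  shows "(\<phi> x, \<phi> y) \<in> sigma M"
proof -
  obtain e where e: "x \<in> carrier F" "y \<in> carrier F" "e \<in> idems F" "e \<otimes>\<^bsub>F\<^esub> x = e \<otimes>\<^bsub>F\<^esub> y"
    using assms by (auto simp: F.sigma_iff)
  then have "\<phi> e \<otimes>\<^bsub>M\<^esub> \<phi> x = \<phi> e \<otimes>\<^bsub>M\<^esub> \<phi> y" by (metis mult F.idems_closed)
  then show ?thesis using e image_idems by (auto simp: M.sigma_iff)
qed

lemma induced_hom_class:
  assumes x: "x \<in> carrier F"
  shows "induced_hom M \<phi> (sigma F `` {x}) = sigma M `` {\<phi> x}"
proof -
  have "sigma M `` {\<phi> y} = sigma M `` {\<phi> x}" if "(x, y) \<in> sigma F" for y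
    using equiv_class_eq[OF M.sigma_equiv image_sigma[OF that]] by simp
  moreover have "(x, x) \<in> sigma F" using equiv_class_self[OF F.sigma_equiv x] by simp
  ultimately show ?thesis unfolding induced_hom_def by blast
qed

text \<open>An idempotent is \<open>sigma\<close>-related to the unit, so the induced homomorphism
  sends the class of \<open>x\<close> to the identity.\<close>

lemma idem_in_induced_kernel:
  assumes "x \<in> carrier F" "\<phi> x \<in> idems M"
  shows "sigma F `` {x} \<in> carrier (induced_kernel M F \<phi>)"
proof -
  have "sigma M `` {\<phi> x} = \<one>\<^bsub>max_group_image M\<^esub>"
    using assms M.idem_sigma_one by (simp add: M.one_max_group_image M.sigma_class_eq_iff)
  then show ?thesis
    using assms
    by (simp add: induced_kernel_def kernel_def induced_hom_class F.sigma_class_closed)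
qed

text \<open>Take any preimage of \<open>x\<close> and pass to the greatest element \<open>X\<close>
  of its class. Its image lies above \<open>x\<close> and in the same \<open>sigma\<close>-class,
  hence in the saturated set \<open>S\<close>, so maximality gives equality. It is applied with
  \<open>S\<close> the whole of \<open>M\<close> for \<open>a\<close>, \<open>b\<close> and with
  \<open>S = v\<close> for \<open>c\<close>, \<open>d\<close>.\<close>

lemma maximal_elems_lift:
  assumes Finv: "F_inverse_monoid F"
    and S: "S \<subseteq> carrier M" "sigma M `` S \<subseteq> S"
    and x: "x \<in> maximal_elems M S"
  shows "\<exists>X\<in>carrier F. \<phi> X = x \<and>
    (\<forall>Y\<in>carrier F. sigma F `` {Y} = sigma F `` {X} \<longrightarrow> Y \<sqsubseteq>\<^bsub>nat_order F\<^esub> X)"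
proof -
  have xS: "x \<in> S" and max: "\<And>y. y \<in> S \<Longrightarrow> x \<sqsubseteq>\<^bsub>nat_order M\<^esub> y \<Longrightarrow> y = x"
    using x by (auto simp: maximal_elems_def)
  have "x \<in> \<phi> ` carrier F" using S(1) xS epi by (auto simp: epi_def)
  then obtain Y where Y: "Y \<in> carrier F" "\<phi> Y = x" by blast
  obtain X where X: "X \<in> carrier F" "sigma F `` {X} = sigma F `` {Y}"
    and gr: "\<And>Z. Z \<in> carrier F \<Longrightarrow> sigma F `` {Z} = sigma F `` {Y} \<Longrightarrow> Z \<sqsubseteq>\<^bsub>nat_order F\<^esub> X"
    using F.F_inverse_class_greatest[OF Finv Y(1)] by blast
  have "(x, \<phi> X) \<in> sigma M"
    using image_sigma[of Y X] X Y F.sigma_class_eq_iff[of Y X] by simp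
  moreover have "x \<sqsubseteq>\<^bsub>nat_order M\<^esub> \<phi> X"
    using image_le[OF gr[OF Y(1) refl] X(1)] Y by simp
  ultimately have "\<phi> X = x" using max S(2) xS by blast
  then show ?thesis using X gr by auto
qed

section \<open>The inequality forced by an Abelian kernel\<close>

lemma abelian_cover_h_sup_le:
  assumes fa: "finite_above M" and eu: "E_unitary M"
    and Finv: "F_inverse_monoid F" and ab_ker: "comm_group (induced_kernel M F \<phi>)"
    and a: "a \<in> maximal_elems M (carrier M)" and b: "b \<in> maximal_elems M (carrier M)"
    and ab: "(a, b) \<in> sigma M"
    and v: "v \<in> carrier (max_group_image M)" and c: "c \<in> maximal_elems M v"
  shows "c \<otimes>\<^bsub>M\<^esub> h_sup M a b v \<otimes>\<^bsub>M\<^esub> inverse_of M c \<otimes>\<^bsub>M\<^esub> b \<sqsubseteq>\<^bsub>nat_order M\<^esub> a"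
proof -
  let ?Q = "max_group_image F"
  let ?cl = "\<lambda>x. sigma F `` {x}"
  interpret Q: group ?Q by (rule F.group_max_group_image)
  note cl_simps = F.sigma_class_mult F.sigma_class_inverse_of F.sigma_class_closed
  have v': "v \<in> carrier M // sigma M" using v by (simp add: quotient_monoid_def)
  note vM = in_quotient_imp_subset[OF M.sigma_equiv v']
  have v_closed: "sigma M `` v \<subseteq> v"
    using in_quotient_imp_closed[OF M.sigma_equiv v'] by blast
  have v_rel: "(x, y) \<in> sigma M" if "x \<in> v" "y \<in> v" for x y
    using in_quotient_imp_in_rel[OF M.sigma_equiv v'] that by simp
  have carr_closed: "sigma M `` carrier M \<subseteq> carrier M" by (auto simp: M.sigma_iff)
  obtain A where A: "A \<in> carrier F" "\<phi> A = a"
    and A_gr: "\<And>Y. Y \<in> carrier F \<Longrightarrow> ?cl Y = ?cl A \<Longrightarrow> Y \<sqsubseteq>\<^bsub>nat_order F\<^esub> A"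
    using maximal_elems_lift[OF Finv subset_refl carr_closed a] by blast
  obtain B where B: "B \<in> carrier F" "\<phi> B = b"
    using maximal_elems_lift[OF Finv subset_refl carr_closed b] by blast
  obtain C where C: "C \<in> carrier F" "\<phi> C = c"
    using maximal_elems_lift[OF Finv vM v_closed c] by blast
  \<comment> \<open>Combined with \<open>idem_in_induced_kernel\<close>, this puts the class of
    \<open>X Y^-1\<close> into the kernel; it yields the kernel elements from \<open>A\<close>,
    \<open>B\<close> and from \<open>D\<close>, \<open>C\<close>.\<close>
  have ker_idem: "\<phi> (X \<otimes>\<^bsub>F\<^esub> inverse_of F Y) \<in> idems M"
    if "X \<in> carrier F" "Y \<in> carrier F" "(\<phi> X, \<phi> Y) \<in> sigma M" for X Y
    using that M.E_unitary_mult_inverse_of_idem[OF eu that(3)] by (simp add: mult image_inverse_of)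
  define n where "n = A \<otimes>\<^bsub>F\<^esub> inverse_of F B"
  have n: "n \<in> carrier F" using A B by (simp add: n_def)
  have n_ker: "?cl n \<in> carrier (induced_kernel M F \<phi>)"
    using A B ab ker_idem idem_in_induced_kernel n by (simp add: n_def)
  \<comment> \<open>The class of \<open>m\<close> is the common value of the classes of
    \<open>D^-1 n D\<close>, computed at \<open>d = c\<close>; \<open>P\<close> is the greatest
    element of this class.\<close>
  define m where "m = inverse_of F C \<otimes>\<^bsub>F\<^esub> n \<otimes>\<^bsub>F\<^esub> C"
  have m: "m \<in> carrier F" using C n by (simp add: m_def)
  obtain P where Pc: "P \<in> carrier F" and Pm: "?cl P = ?cl m"
    and P_gr: "\<And>Y. Y \<in> carrier F \<Longrightarrow> ?cl Y = ?cl m \<Longrightarrow> Y \<sqsubseteq>\<^bsub>nat_order F\<^esub> P"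
    using F.F_inverse_class_greatest[OF Finv m] by blast
  have "x \<sqsubseteq>\<^bsub>nat_order M\<^esub> \<phi> P" if xH: "x \<in> H_set M a b v" for x
  proof -
    obtain d where d: "d \<in> maximal_elems M v"
      and x: "x = inverse_of M d \<otimes>\<^bsub>M\<^esub> a \<otimes>\<^bsub>M\<^esub> inverse_of M b \<otimes>\<^bsub>M\<^esub> d"
      using xH unfolding H_set_def by blast
    obtain D where D: "D \<in> carrier F" "\<phi> D = d"
      using maximal_elems_lift[OF Finv vM v_closed d] by blast
    have "(\<phi> D, \<phi> C) \<in> sigma M"
      using c d C D v_rel by (auto simp: maximal_elems_def)
    then have "?cl (D \<otimes>\<^bsub>F\<^esub> inverse_of F C) \<in> carrier (induced_kernel M F \<phi>)"
      using C D by (intro idem_in_induced_kernel ker_idem) auto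
    \<comment> \<open>The kernel has the multiplication of the maximal group image of
      \<open>F\<close>, so commutativity there is an equation in that group.\<close>
    then have "?cl (D \<otimes>\<^bsub>F\<^esub> inverse_of F C) \<otimes>\<^bsub>?Q\<^esub> ?cl n = ?cl n \<otimes>\<^bsub>?Q\<^esub> ?cl (D \<otimes>\<^bsub>F\<^esub> inverse_of F C)"
      using comm_monoid.m_comm[OF comm_group.axioms(1)[OF ab_ker] _ n_ker]
      by (simp add: induced_kernel_def)
    then have "?cl (inverse_of F D \<otimes>\<^bsub>F\<^esub> n \<otimes>\<^bsub>F\<^esub> D) = ?cl m"
      using C D n Q.conj_eq_of_commute[of "?cl C" "?cl D" "?cl n"] by (simp add: m_def cl_simps)
    \<comment> \<open>The element \<open>D^-1 n D\<close> is in the class of \<open>P\<close>, hence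
      below \<open>P\<close>, and its image in \<open>M\<close> is exactly \<open>x\<close>.\<close>
    then have "\<phi> (inverse_of F D \<otimes>\<^bsub>F\<^esub> n \<otimes>\<^bsub>F\<^esub> D) \<sqsubseteq>\<^bsub>nat_order M\<^esub> \<phi> P"
      using D n Pc by (intro image_le P_gr) auto
    then show ?thesis
      using A(1) B(1) D(1) unfolding x A(2)[symmetric] B(2)[symmetric] D(2)[symmetric]
      by (simp add: n_def mult image_inverse_of M.m_assoc)
  qed
  then have "\<phi> P \<in> Upper (nat_order M) (H_set M a b v)"
    using Pc by (auto simp: Upper_def)
  moreover note M.h_sup_least[OF fa eu ab vM c]
  ultimately have hP: "h_sup M a b v \<sqsubseteq>\<^bsub>nat_order M\<^esub> \<phi> P" and hc: "h_sup M a b v \<in> carrier M"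
    by (auto simp: least_def Upper_def)
  have carr: "a \<in> carrier M" "b \<in> carrier M" "c \<in> carrier M" using A B C by auto
  have "c \<otimes>\<^bsub>M\<^esub> h_sup M a b v \<otimes>\<^bsub>M\<^esub> inverse_of M c \<otimes>\<^bsub>M\<^esub> b
      \<sqsubseteq>\<^bsub>nat_order M\<^esub> c \<otimes>\<^bsub>M\<^esub> \<phi> P \<otimes>\<^bsub>M\<^esub> inverse_of M c \<otimes>\<^bsub>M\<^esub> b"
    using hP hc carr Pc by (intro M.nat_order_mult_right M.nat_order_mult_left) auto
  also have "c \<otimes>\<^bsub>M\<^esub> \<phi> P \<otimes>\<^bsub>M\<^esub> inverse_of M c \<otimes>\<^bsub>M\<^esub> b = \<phi> (C \<otimes>\<^bsub>F\<^esub> P \<otimes>\<^bsub>F\<^esub> inverse_of F C \<otimes>\<^bsub>F\<^esub> B)"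
    using B C Pc by (simp add: mult image_inverse_of)
  finally have 1: "c \<otimes>\<^bsub>M\<^esub> h_sup M a b v \<otimes>\<^bsub>M\<^esub> inverse_of M c \<otimes>\<^bsub>M\<^esub> b
      \<sqsubseteq>\<^bsub>nat_order M\<^esub> \<phi> (C \<otimes>\<^bsub>F\<^esub> P \<otimes>\<^bsub>F\<^esub> inverse_of F C \<otimes>\<^bsub>F\<^esub> B)" .
  \<comment> \<open>In the group, \<open>P\<close> has the class of \<open>C^-1 A B^-1 C\<close>, so
    in \<open>C P C^-1 B\<close> everything cancels except the class of \<open>A\<close>. As
    \<open>A\<close> is greatest in its class, the image is below \<open>a\<close>.\<close>
  have "?cl (C \<otimes>\<^bsub>F\<^esub> P \<otimes>\<^bsub>F\<^esub> inverse_of F C \<otimes>\<^bsub>F\<^esub> B) = ?cl A"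
    using A B C Pc n
    by (simp add: cl_simps Pm m_def n_def Q.m_assoc)
      (simp add: cl_simps flip: Q.m_assoc)
  then have "\<phi> (C \<otimes>\<^bsub>F\<^esub> P \<otimes>\<^bsub>F\<^esub> inverse_of F C \<otimes>\<^bsub>F\<^esub> B) \<sqsubseteq>\<^bsub>nat_order M\<^esub> \<phi> A"
    using A B C Pc by (intro image_le A_gr) auto
  then show ?thesis using M.nat_order_trans[OF 1] A carr by simp
qed

end

theorem theorem4p3:
  fixes M :: "('a, 'm) monoid_scheme" (structure)
  assumes "inverse_monoid M" and "finite_above M" and "E_unitary M"
    and "\<exists>a \<in> maximal_elems M (carrier M). \<exists>b \<in> maximal_elems M (carrier M). (a, b) \<in> sigma M \<and>
           (\<exists>v \<in> carrier (max_group_image M). \<exists>c \<in> maximal_elems M v.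
              \<not> c \<otimes> h_sup M a b v \<otimes> inverse_of M c \<otimes> b \<sqsubseteq>\<^bsub>nat_order M\<^esub> a)"
  shows "\<not> (\<exists>(F :: 'b monoid) \<phi>. F_inverse_cover_via comm_group M F \<phi>)"
proof
  assume "\<exists>(F :: 'b monoid) \<phi>. F_inverse_cover_via comm_group M F \<phi>"
  then obtain F :: "'b monoid" and \<phi> where F: "F_inverse_monoid F" "\<phi> \<in> epi F M"
    and ker: "comm_group (induced_kernel M F \<phi>)"
    by (auto simp: F_inverse_cover_via_def F_inverse_cover_def)
  interpret inverse_monoid_epi F M \<phi>
    using F assms(1)
    by (simp add: inverse_monoid_epi_def inverse_monoid_epi_axioms_def F_inverse_monoid_def)
  show False
    using assms(4) abelian_cover_h_sup_le[OF assms(2,3) F(1) ker] by blast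
qed

end
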